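(* Write $A_1=\{a_0,\dots,a_k\}=\bigsqcup_{j=0}^r[b_{2j},b_{2j+1}]$ (disjoint union of integer intervals), where $0=:b_0\le b_1<b_2\le b_3<\cdots<b_{2r}\le b_{2r+1}:=d$, $b_{2j-1}+2\le b_{2j}$ for $j=1,\dots,r$, and $r\ge 2$. If $b_1=0$, $b_{2r}<d$ and $b_5-b_4+1\ge b_2$, then $$\mathrm{reg}(K[S])\le 2+\max\left\{\left\lfloor\frac{\lambda_{\mathrm{sl}}}{d-b_{2r}}\right\rfloor+\left\lfloor\frac{\lambda_{\max}}{b_2}\right\rfloor;\ \left\lfloor\frac{\lambda_{\max}}{d-b_{2r}}\right\rfloor+\left\lfloor\frac{\lambda_{\mathrm{sl}}}{b_2}\right\rfloor\right\}.$$
   Context: Let $K$ be a field, $k\ge 3$, and let $0=:a_0<a_1<\cdots<a_k=:d$ be integers with $\gcd(a_1,\dots,a_k)=1$; $A_1=\{a_0,\dots,a_k\}$. For integers $p\le q$, $[p,q]$ is the set of integers $n$ with $p\le n\le q$. Let $S\subset\mathbb N^2$ be the additive monoid generated by $(a_i,d-a_i)$, $0\le i\le k$, and $K[S]$ its semigroup ring (isomorphic to $K[s^{a_i}t^{d-a_i}\mid 0\le i\le k]$), graded by $\deg(u_1,u_2)=(u_1+u_2)/d$, with maximal homogeneous ideal $\mathfrak m$. Put $a_i(K[S])=\sup\{n\mid H^i_{\mathfrak m}(K[S])_n\ne0\}$ (with $\sup\emptyset=-\infty$; not to be confused with the integers $a_i$); the Castelnuovo--Mumford regularity is $\mathrm{reg}(K[S])=\max\{a_1(K[S])+1,\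 a_2(K[S])+2\}$. The gaps of $A_1$ are $\lambda_i=a_i-a_{i-1}-1$, $1\le i\le k$. $\lambda_{\max}$ is the largest gap, $\lambda_{\max}=\lambda_i$ for some $i$, and $\lambda_{\mathrm{sl}}=\max\{\lambda_j\mid j\neq i\}$ is the second largest gap (counted with multiplicity). *)

theory Defs
  imports Complex_Main "HOL-Library.Poly_Mapping" "HOL-Library.Extended_Real"
    "HOL-Library.Product_Plus" "HOL-Library.Disjoint_Sets"
begin

section \<open>Local cohomology through the Cech complex\<close>

text \<open>
  Let \<open>R\<close> be a subring of a commutative ring \<open>'a\<close> and let \<open>x\<^sub>0, \<dots>, x\<^sub>N\<close> be elements of \<open>R\<close> that
  are units of \<open>'a\<close>. For \<open>f\<close> a product of some of the \<open>x\<^sub>j\<close>, the localization of \<open>R\<close> at \<open>f\<close>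
  is then the subring \<open>R[1/f]\<close> of \<open>'a\<close>, and all localization maps are inclusions.
  The local cohomology of \<open>R\<close> with support in the ideal generated by \<open>x\<^sub>0, \<dots>, x\<^sub>N\<close> is the
  cohomology of the Cech complex
  \<open>0 \<rightarrow> R \<rightarrow> \<Oplus>\<^sub>j R[1/x\<^sub>j] \<rightarrow> \<Oplus>\<^sub>i\<^sub><\<^sub>j R[1/(x\<^sub>i x\<^sub>j)] \<rightarrow> \<dots>\<close>.
\<close>

definition localization :: "'a::comm_ring_1 set \<Rightarrow> 'a \<Rightarrow> 'a set" where
  "localization R f = {q. \<exists>n::nat. f ^ n * q \<in> R}"

text \<open>
  A cochain of degree \<open>i\<close> is a family indexed by the \<open>i\<close>-element subsets of \<open>{0, \<dots>, N}\<close>; as a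
  total function it is set to 0 on all other sets.
\<close>

definition cech_cochains ::
    "'a::comm_ring_1 set \<Rightarrow> (nat \<Rightarrow> 'a) \<Rightarrow> nat \<Rightarrow> nat \<Rightarrow> (nat set \<Rightarrow> 'a) set" where
  "cech_cochains R x N i =
     {c. \<forall>F. if F \<subseteq> {..N} \<and> card F = i then c F \<in> localization R (\<Prod>j\<in>F. x j) else c F = 0}"

definition cech_diff :: "nat \<Rightarrow> nat \<Rightarrow> (nat set \<Rightarrow> 'a::comm_ring_1) \<Rightarrow> (nat set \<Rightarrow> 'a)" where
  "cech_diff N i c =
     (\<lambda>F. if F \<subseteq> {..N} \<and> card F = Suc i
          then (\<Sum>j\<in>F. (- 1) ^ card {l \<in> F. l < j} * c (F - {j})) else 0)"

definition cech_cocycles ::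
    "'a::comm_ring_1 set \<Rightarrow> (nat \<Rightarrow> 'a) \<Rightarrow> nat \<Rightarrow> nat \<Rightarrow> (nat set \<Rightarrow> 'a) set" where
  "cech_cocycles R x N i = {c \<in> cech_cochains R x N i. cech_diff N i c = (\<lambda>F. 0)}"

definition cech_coboundaries ::
    "'a::comm_ring_1 set \<Rightarrow> (nat \<Rightarrow> 'a) \<Rightarrow> nat \<Rightarrow> nat \<Rightarrow> (nat set \<Rightarrow> 'a) set" where
  "cech_coboundaries R x N i =
     (if i = 0 then {\<lambda>F. 0} else cech_diff N (i - 1) ` cech_cochains R x N (i - 1))"

text \<open>
  If \<open>'a\<close> is graded by subgroups \<open>G n\<close>, the component \<open>H\<^sup>i\<^sub>n\<close> consists of the classes (cosets modulo
  the coboundaries) of the cocycles that are homogeneous of degree \<open>n\<close>. It is the zero module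
  iff its only element is the zero coset.
\<close>

definition local_cohomology_component ::
    "'a::comm_ring_1 set \<Rightarrow> (nat \<Rightarrow> 'a) \<Rightarrow> nat \<Rightarrow> (int \<Rightarrow> 'a set) \<Rightarrow> nat \<Rightarrow> int
      \<Rightarrow> (nat set \<Rightarrow> 'a) set set" where
  "local_cohomology_component R x N G i n =
     (\<lambda>c. {(\<lambda>F. c F + b F) |b. b \<in> cech_coboundaries R x N i}) `
       {c \<in> cech_cocycles R x N i. \<forall>F. c F \<in> G n}"

definition a_invariant ::
    "'a::comm_ring_1 set \<Rightarrow> (nat \<Rightarrow> 'a) \<Rightarrow> nat \<Rightarrow> (int \<Rightarrow> 'a set) \<Rightarrow> nat \<Rightarrow> ereal" where
  "a_invariant R x N G i =
     Sup ((\<lambda>n. ereal (of_int n)) `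
       {n. local_cohomology_component R x N G i n \<noteq> {cech_coboundaries R x N i}})"

section \<open>The semigroup ring of a projective monomial curve\<close>

text \<open>
  The sequence \<open>a\<close> stands for \<open>a 0 < \<dots> < a k = d\<close>. The semigroup \<open>S\<close> is regarded as
  a subset of the group \<open>int \<times> int\<close>.
\<close>

definition curve_gen :: "(nat \<Rightarrow> int) \<Rightarrow> nat \<Rightarrow> nat \<Rightarrow> int \<times> int" where
  "curve_gen a k i = (a i, a k - a i)"

inductive_set curve_semigroup :: "(nat \<Rightarrow> int) \<Rightarrow> nat \<Rightarrow> (int \<times> int) set"
  for a :: "nat \<Rightarrow> int" and k :: nat where
  zero: "0 \<in> curve_semigroup a k"
| gen: "i \<le> k \<Longrightarrow> curve_gen a k i \<in> curve_semigroup a k"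
| add: "u \<in> curve_semigroup a k \<Longrightarrow> v \<in> curve_semigroup a k \<Longrightarrow> u + v \<in> curve_semigroup a k"

text \<open>
  The type \<open>(int \<times> int) \<Rightarrow>\<^sub>0 'k\<close> with its convolution product is the group algebra of \<open>\<int>\<^sup>2\<close>, that is,
  the Laurent polynomial ring in \<open>s, t\<close>, in which all monomials are units.
\<close>

definition semigroup_ring :: "(int \<times> int) set \<Rightarrow> ((int \<times> int) \<Rightarrow>\<^sub>0 'k::field) set" where
  "semigroup_ring S = {p. Poly_Mapping.keys p \<subseteq> S}"

definition homogeneous_part :: "int \<Rightarrow> int \<Rightarrow> ((int \<times> int) \<Rightarrow>\<^sub>0 'k::field) set" where
  "homogeneous_part d n = {p. \<forall>u \<in> Poly_Mapping.keys p. fst u + snd u = n * d}"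

text \<open>
  The maximal homogeneous ideal of \<open>K[S]\<close> is generated by the monomials
  with exponents \<open>curve_gen a k i\<close>, \<open>i \<le> k\<close>.
\<close>

definition curve_monomial :: "(nat \<Rightarrow> int) \<Rightarrow> nat \<Rightarrow> nat \<Rightarrow> (int \<times> int) \<Rightarrow>\<^sub>0 'k::field" where
  "curve_monomial a k i = Poly_Mapping.single (curve_gen a k i) 1"

definition curve_a_invariant :: "'k::field itself \<Rightarrow> (nat \<Rightarrow> int) \<Rightarrow> nat \<Rightarrow> nat \<Rightarrow> ereal" where
  "curve_a_invariant K a k i =
     a_invariant (semigroup_ring (curve_semigroup a k) :: ((int \<times> int) \<Rightarrow>\<^sub>0 'k) set)
       (curve_monomial a k) k (homogeneous_part (a k)) i"

definition curve_reg :: "'k::field itself \<Rightarrow> (nat \<Rightarrow> int) \<Rightarrow> nat \<Rightarrow> ereal" where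
  "curve_reg K a k = max (curve_a_invariant K a k 1 + 1) (curve_a_invariant K a k 2 + 2)"

section \<open>Gaps\<close>

definition gap :: "(nat \<Rightarrow> int) \<Rightarrow> nat \<Rightarrow> int" where
  "gap a i = a i - a (i - 1) - 1"

definition gap_max :: "(nat \<Rightarrow> int) \<Rightarrow> nat \<Rightarrow> int" where
  "gap_max a k = Max (gap a ` {1..k})"

text \<open>The value does not depend on which index attaining the largest gap is removed.\<close>

definition gap_second :: "(nat \<Rightarrow> int) \<Rightarrow> nat \<Rightarrow> int" where
  "gap_second a k = (let i = (SOME i. i \<in> {1..k} \<and> gap a i = gap_max a k)
                     in Max (gap a ` ({1..k} - {i})))"

end

theory Submission
  imports Defs
begin

text \<open>
  Degree by degree, the Cech complex is governed by \<open>S - \<nat> e\<^sub>0\<close> and \<open>S - \<nat> e\<^sub>k\<close>, where \<open>e\<^sub>0\<close> and \<open>e\<^sub>k\<close>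
  are the extremal generators: \<open>H\<^sup>1\<close> vanishes in degree \<open>n\<close> if their intersection
  lies in \<open>S\<close> there, and \<open>H\<^sup>2\<close> if their union is everything.

  Put \<open>\<epsilon> = b\<^sub>2\<close>, \<open>\<delta> = d - b\<^sub>2\<^sub>r\<close>, and let \<open>\<mu>\<close> be the largest gap. Since \<open>1 \<in> d - A\<close>, the first
  condition says that every \<open>x \<le> n * d\<close> in the monoid generated by \<open>A\<close> is a sum of \<open>n\<close> elements
  of \<open>A\<close>. For \<open>x \<ge> b\<^sub>4\<close> write \<open>x = (x - b\<^sub>4 - s) + (b\<^sub>4 + s)\<close>. With \<open>c = (x - b\<^sub>4) div d\<close>, using \<open>c\<close>
  summands from the top interval shortens the gaps by \<open>c * \<delta>\<close>, so some \<open>s \<le> max 0 (\<mu> - c * \<delta>)\<close>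
  makes \<open>x - b\<^sub>4 - s\<close> a sum of \<open>c + 1\<close> elements, and since \<open>[b\<^sub>4, b\<^sub>5]\<close> has at least \<open>\<epsilon>\<close> elements,
  \<open>b\<^sub>4 + s\<close> is a sum of \<open>1 + s div \<epsilon>\<close>. If \<open>c * \<delta> \<le> \<mu>\<close>, the total is at most
  \<open>2 + max (\<mu> div \<delta>) (\<mu> div \<epsilon>)\<close>, because \<open>c + (\<mu> - c * \<delta>) / \<epsilon>\<close> is affine in \<open>c\<close>; if \<open>c * \<delta> > \<mu>\<close>,
  no gaps are left and \<open>x\<close> itself is a sum of \<open>x div d + 1\<close> elements. For \<open>x < b\<^sub>4\<close> one counts
  multiples of \<open>\<epsilon>\<close>, distinguishing whether \<open>[b\<^sub>2, b\<^sub>3]\<close> has \<open>\<epsilon>\<close> elements.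
\<close>

section \<open>Sumsets\<close>

text \<open>Exactly \<open>n\<close> summands are required, because \<open>n\<close> becomes the
  degree in the semigroup; once \<open>0 \<in> A\<close>, this is the same as at most
  \<open>n\<close> summands.\<close>

fun nfold_sumset :: "int set \<Rightarrow> nat \<Rightarrow> int set" where
  "nfold_sumset A 0 = {0}"
| "nfold_sumset A (Suc n) = {a + s |a s. a \<in> A \<and> s \<in> nfold_sumset A n}"

lemma nfold_sumset_add:
  "x \<in> nfold_sumset A m \<Longrightarrow> y \<in> nfold_sumset A n \<Longrightarrow> x + y \<in> nfold_sumset A (m + n)"
proof (induction m arbitrary: x)
  case (Suc m)
  then obtain a s where "x = a + s" "a \<in> A" "s \<in> nfold_sumset A m" by auto
  with Suc show ?case by (fastforce simp: add.assoc)
qed simp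

lemma nfold_sumset_Suc:
  "a \<in> A \<Longrightarrow> x \<in> nfold_sumset A n \<Longrightarrow> a + x \<in> nfold_sumset A (Suc n)"
  by auto

lemma nfold_sumset_mono:
  assumes "0 \<in> A" "m \<le> n" "x \<in> nfold_sumset A m"
  shows "x \<in> nfold_sumset A n"
  using assms(2,3)
proof (induction n rule: dec_induct)
  case (step n)
  then show ?case using nfold_sumset_Suc[OF assms(1), of x n] by simp
qed simp

lemma nfold_sumset_scale: "a \<in> A \<Longrightarrow> int n * a \<in> nfold_sumset A n"
  by (induction n) (auto simp: algebra_simps)

text \<open>Each of the \<open>c\<close> summands \<open>d\<close> may be lowered by up to
  \<open>\<delta>\<close> inside the top interval. The deficit \<open>t\<close> is spread greedily,
  \<open>min t \<delta>\<close> at a time.\<close>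

lemma nfold_sumset_top:
  assumes "{d - \<delta>..d} \<subseteq> A" "\<delta> \<ge> 0"
  shows "0 \<le> t \<Longrightarrow> t \<le> int c * \<delta> \<Longrightarrow> int c * d - t \<in> nfold_sumset A c"
proof (induction c arbitrary: t)
  case (Suc c)
  have "0 \<le> t - min t \<delta>" "t - min t \<delta> \<le> int c * \<delta>"
    using Suc.prems assms(2) by (auto simp: algebra_simps min_def)
  then have "int c * d - (t - min t \<delta>) \<in> nfold_sumset A c" by (rule Suc.IH)
  moreover have "d - min t \<delta> \<in> A" using assms Suc.prems by auto
  ultimately have "(d - min t \<delta>) + (int c * d - (t - min t \<delta>)) \<in> nfold_sumset A (Suc c)"
    by (intro nfold_sumset_Suc)
  then show ?case by (simp add: algebra_simps)
qed auto

text \<open>Nonzero summands are at least \<open>\<epsilon>\<close>, so at most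
  \<open>x div \<epsilon>\<close> of them occur; zeros are discarded and refilled to reach exactly
  that number.\<close>

lemma nfold_sumset_div:
  assumes "0 < \<epsilon>" "\<And>a. a \<in> A \<Longrightarrow> a \<noteq> 0 \<Longrightarrow> \<epsilon> \<le> a" "0 \<in> A"
  shows "x \<in> nfold_sumset A m \<Longrightarrow> 0 \<le> x \<and> x \<in> nfold_sumset A (nat (x div \<epsilon>))"
proof (induction m arbitrary: x)
  case (Suc m)
  then obtain a s where x: "x = a + s" "a \<in> A" "s \<in> nfold_sumset A m" by auto
  note IH = Suc.IH[OF x(3)]
  show ?case
  proof (cases "a = 0")
    case False
    then have a: "\<epsilon> \<le> a" using assms x by blast
    then have "s div \<epsilon> + 1 \<le> x div \<epsilon>"
      using assms(1) zdiv_mono1[of "s + \<epsilon>" x \<epsilon>] x(1) by simp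
    moreover have "0 \<le> s div \<epsilon>" using IH assms(1) by (simp add: pos_imp_zdiv_nonneg_iff)
    ultimately have "Suc (nat (s div \<epsilon>)) \<le> nat (x div \<epsilon>)" by linarith
    then show ?thesis
      using nfold_sumset_mono[OF assms(3)] nfold_sumset_Suc[OF x(2)] IH x(1) a assms(1)
      by (metis add_nonneg_nonneg less_le_not_le linorder_linear order_trans)
  qed (use IH x in simp)
qed (use assms in auto)

text \<open>The block contains \<open>p + s mod \<epsilon>\<close>, one element for each residue;
  the rest of \<open>s\<close> is \<open>s div \<epsilon>\<close> copies of
  \<open>\<epsilon>\<close>.\<close>

lemma nfold_sumset_block:
  assumes "{p..p + \<epsilon> - 1} \<subseteq> A" "\<epsilon> \<in> A" "0 < \<epsilon>" "0 \<le> s"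
  shows "p + s \<in> nfold_sumset A (Suc (nat (s div \<epsilon>)))"
proof -
  have "p + s mod \<epsilon> \<in> A" using assms pos_mod_bound[of \<epsilon> s] by (auto simp: pos_mod_sign)
  moreover have "int (nat (s div \<epsilon>)) * \<epsilon> \<in> nfold_sumset A (nat (s div \<epsilon>))"
    by (rule nfold_sumset_scale) fact
  ultimately have "(p + s mod \<epsilon>) + int (nat (s div \<epsilon>)) * \<epsilon>
      \<in> nfold_sumset A (Suc (nat (s div \<epsilon>)))"
    by (rule nfold_sumset_Suc)
  moreover have "0 \<le> s div \<epsilon>" using assms by (simp add: pos_imp_zdiv_nonneg_iff)
  ultimately show ?thesis by (simp add: algebra_simps)
qed

section \<open>Sets with bounded gaps and a full interval at the top\<close>

locale gap_set =
  fixes A :: "int set" and d \<delta> \<mu> :: int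
  assumes zero_mem: "0 \<in> A" and d_mem: "d \<in> A"
    and d_pos: "0 < d" and top: "{d - \<delta>..d} \<subseteq> A" and \<delta>_pos: "0 < \<delta>"
    and \<mu>_nonneg: "0 \<le> \<mu>"
    and gaps: "\<And>y. 0 \<le> y \<Longrightarrow> y \<le> d \<Longrightarrow> y \<notin> A \<Longrightarrow>
      \<exists>l h. l \<in> A \<and> h \<in> A \<and> l < y \<and> y < h \<and> h - l - 1 \<le> \<mu>"
begin

text \<open>Adding \<open>c\<close> summands from the top interval turns each
  \<open>a \<in> A\<close> into the whole interval from \<open>c * d + a - c * \<delta>\<close> to
  \<open>c * d + a\<close>. A hole below \<open>h\<close> is thus filled from above by
  \<open>c * \<delta>\<close> places, and \<open>s\<close> measures the way down to a reachable
  integer.\<close>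

lemma shrunken_gap:
  assumes "0 \<le> x"
  defines "c \<equiv> x div d"
  shows "\<exists>s \<ge> 0. s \<le> max 0 (\<mu> - c * \<delta>) \<and> x - s \<in> nfold_sumset A (Suc (nat c))"
proof -
  define y where "y = x mod d"
  have x: "x = c * d + y" unfolding c_def y_def by simp
  have y: "0 \<le> y" "y < d" unfolding y_def using d_pos by auto
  have c: "0 \<le> c" unfolding c_def using assms d_pos by (simp add: pos_imp_zdiv_nonneg_iff)
  have *: "c * d + a - t \<in> nfold_sumset A (Suc (nat c))"
    if "a \<in> A" "0 \<le> t" "t \<le> c * \<delta>" for a t
    using nfold_sumset_Suc[OF that(1) nfold_sumset_top[OF top, of t "nat c"]] that \<delta>_pos c
    by (simp add: algebra_simps)
  show ?thesis
  proof (cases "y \<in> A")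
    case True
    then show ?thesis using *[OF True, of 0] c \<delta>_pos x by (intro exI[of _ 0]) auto
  next
    case False
    then obtain l h where lh: "l \<in> A" "h \<in> A" "l < y" "y < h" "h - l - 1 \<le> \<mu>"
      using gaps y by (meson less_imp_le)
    show ?thesis
    \<comment> \<open>Either \<open>y\<close> is reached from \<open>h\<close> by lowering, or it
      lies in the part of the hole left over, where
      \<open>y - l \<le> \<mu> - c * \<delta>\<close>.\<close>
    proof (cases "h - c * \<delta> \<le> y")
      case True
      then show ?thesis using *[OF lh(2), of "h - y"] lh x by (intro exI[of _ 0]) auto
    next
      case False
      then show ?thesis using *[OF lh(1), of 0] lh x c \<delta>_pos by (intro exI[of _ "y - l"]) auto
    qed
  qed
qed

lemma mem_of_long_block:
  assumes block: "{p..p + \<epsilon> - 1} \<subseteq> A" and \<epsilon>: "\<epsilon> \<in> A" "0 < \<epsilon>" and p: "0 < p"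
    and x: "p \<le> x" "x \<le> int n * d"
    and n: "2 + max (\<mu> div \<delta>) (\<mu> div \<epsilon>) \<le> int n"
  shows "x \<in> nfold_sumset A n"
proof -
  define c where "c = (x - p) div d"
  have c: "0 \<le> c" unfolding c_def using x d_pos by (simp add: pos_imp_zdiv_nonneg_iff)
  show ?thesis
  proof (cases "c * \<delta> \<le> \<mu>")
    case True
    obtain s where s: "0 \<le> s" "s \<le> max 0 (\<mu> - c * \<delta>)"
      "x - p - s \<in> nfold_sumset A (Suc (nat c))"
      using shrunken_gap[of "x - p"] x unfolding c_def by auto
    have s': "s \<le> \<mu> - c * \<delta>" using s True by auto
    \<comment> \<open>With \<open>c * \<delta> + s \<le> \<mu>\<close>, the smaller of
      \<open>\<delta>\<close> and \<open>\<epsilon>\<close> can serve for both: lowering the weight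
      of \<open>c\<close> to \<open>\<epsilon>\<close>, or the divisor of \<open>s\<close> to
      \<open>\<delta>\<close>, leaves a single quotient of \<open>\<mu>\<close>.\<close>
    have "c + s div \<epsilon> \<le> max (\<mu> div \<delta>) (\<mu> div \<epsilon>)"
    proof (cases "\<epsilon> \<le> \<delta>")
      case True
      then have "c * \<epsilon> \<le> c * \<delta>" using c by (intro mult_left_mono)
      then have "s \<le> \<mu> - c * \<epsilon>" using s' by linarith
      then have "(c * \<epsilon> + s) div \<epsilon> \<le> \<mu> div \<epsilon>" using \<epsilon> by (intro zdiv_mono1) auto
      then show ?thesis using \<epsilon> by simp
    next
      case False
      have "s div \<epsilon> \<le> s div \<delta>" using False s \<delta>_pos by (intro zdiv_mono2) auto
      moreover have "(c * \<delta> + s) div \<delta> \<le> \<mu> div \<delta>" using \<delta>_pos s' by (intro zdiv_mono1) auto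
      ultimately show ?thesis using \<delta>_pos by simp
    qed
    moreover have "0 \<le> s div \<epsilon>" using s \<epsilon> by (simp add: pos_imp_zdiv_nonneg_iff)
    ultimately have "Suc (nat c) + Suc (nat (s div \<epsilon>)) \<le> n" using n c by linarith
    moreover have "(x - p - s) + (p + s) \<in> nfold_sumset A (Suc (nat c) + Suc (nat (s div \<epsilon>)))"
      by (intro nfold_sumset_add s(3) nfold_sumset_block block \<epsilon> s(1))
    ultimately show ?thesis using nfold_sumset_mono[OF zero_mem] by simp
  next
    case False
    \<comment> \<open>The endpoint is treated apart, since \<open>x div d + 1\<close> would be
      \<open>n + 1\<close> there.\<close>
    show ?thesis
    proof (cases "x = int n * d")
      case True
      then show ?thesis using nfold_sumset_scale d_mem by blast
    next
      case x_less: False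
      have "c \<le> x div d" unfolding c_def using p d_pos by (intro zdiv_mono1) auto
      then have "c * \<delta> \<le> x div d * \<delta>" using \<delta>_pos by (intro mult_right_mono) auto
      from this False have "\<mu> - x div d * \<delta> \<le> 0" by linarith
      moreover obtain s where "0 \<le> s" "s \<le> max 0 (\<mu> - x div d * \<delta>)"
        "x - s \<in> nfold_sumset A (Suc (nat (x div d)))"
        using shrunken_gap[of x] x p by auto
      ultimately have "x \<in> nfold_sumset A (Suc (nat (x div d)))"
        by (simp del: nfold_sumset.simps)
      moreover have "x div d < int n"
      proof (rule ccontr)
        assume "\<not> x div d < int n"
        then have "int n * d \<le> x div d * d" using d_pos by (intro mult_right_mono) auto
        also have "\<dots> \<le> x" using d_pos pos_mod_sign[of d x] div_mult_mod_eq[of x d] by linarith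
        finally show False using x x_less by simp
      qed
      moreover have "0 \<le> x div d" using x p d_pos by (simp add: pos_imp_zdiv_nonneg_iff)
      ultimately have "x \<in> nfold_sumset A (Suc (nat (x div d)))" "Suc (nat (x div d)) \<le> n"
        by (auto simp del: nfold_sumset.simps)
      then show ?thesis using nfold_sumset_mono[OF zero_mem] by blast
    qed
  qed
qed

end

text \<open>If \<open>[\<epsilon>, e]\<close> has fewer than \<open>\<epsilon>\<close> elements,
  then \<open>x < p\<close> forces \<open>x \<le> \<mu> + 2 * \<epsilon>\<close>, and counting
  nonzero summands suffices. Otherwise the interval contains a block of length
  \<open>\<epsilon>\<close> from which everything above is reached.\<close>

lemma mem_of_small:
  assumes zero: "0 \<in> A" and \<epsilon>: "0 < \<epsilon>" "\<And>a. a \<in> A \<Longrightarrow> a \<noteq> 0 \<Longrightarrow> \<epsilon> \<le> a"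
    and block: "{\<epsilon>..e} \<subseteq> A" "\<epsilon> \<le> e" and gap: "p - e - 1 \<le> \<mu>" "0 \<le> \<mu>"
    and x: "x \<in> nfold_sumset A m" "x < p" and n: "2 + \<mu> div \<epsilon> \<le> int n"
  shows "x \<in> nfold_sumset A n"
proof -
  note div = nfold_sumset_div[OF \<epsilon> zero x(1)]
  have q0: "0 \<le> \<mu> div \<epsilon>" using gap \<epsilon> by (simp add: pos_imp_zdiv_nonneg_iff)
  have \<epsilon>A: "\<epsilon> \<in> A" using block by auto
  show ?thesis
  proof (cases "e - \<epsilon> + 1 < \<epsilon>")
    case True
    then have "x div \<epsilon> \<le> (\<mu> + 2 * \<epsilon>) div \<epsilon>" using gap x \<epsilon> by (intro zdiv_mono1) auto
    then have "nat (x div \<epsilon>) \<le> n" using n \<epsilon> by simp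
    then show ?thesis using nfold_sumset_mono[OF zero] div by blast
  next
    case long: False
    consider "x < \<epsilon>" | "\<epsilon> \<le> x" "x \<le> e" | "e < x" by linarith
    then show ?thesis
    proof cases
      case 1
      then have "x div \<epsilon> = 0" using div by simp
      then show ?thesis using nfold_sumset_mono[OF zero, of 0 n x] div by simp
    next
      case 2
      then have "x \<in> A" using block by auto
      then have "x \<in> nfold_sumset A 1" by simp
      then show ?thesis using nfold_sumset_mono[OF zero, of 1 n x] n q0 by simp
    next
      case 3
      \<comment> \<open>The block consists of the last \<open>\<epsilon>\<close> elements of
        \<open>[\<epsilon>, e]\<close>, which keeps the remainder \<open>s\<close> below
        \<open>\<mu> + \<epsilon>\<close>.\<close>
      define s where "s = x - (e - \<epsilon> + 1)"
      have s: "0 \<le> s" unfolding s_def using 3 \<epsilon> by simp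
      have "{(e - \<epsilon> + 1)..(e - \<epsilon> + 1) + \<epsilon> - 1} \<subseteq> A" using block long by auto
      from nfold_sumset_block[OF this \<epsilon>A \<epsilon>(1) s]
      have "x \<in> nfold_sumset A (Suc (nat (s div \<epsilon>)))" unfolding s_def by simp
      moreover have "s div \<epsilon> \<le> (\<mu> + \<epsilon>) div \<epsilon>"
        unfolding s_def using gap x \<epsilon> by (intro zdiv_mono1) auto
      then have "Suc (nat (s div \<epsilon>)) \<le> n" using n \<epsilon> q0 by simp
      ultimately show ?thesis using nfold_sumset_mono[OF zero] by blast
    qed
  qed
qed

section \<open>Cech cohomology in degrees 1 and 2\<close>

locale cech =
  fixes R :: "'a::comm_ring_1 set" and x :: "nat \<Rightarrow> 'a" and N :: nat
  assumes zero_mem: "0 \<in> R" and one_mem: "1 \<in> R"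
    and diff_mem: "\<And>p q. p \<in> R \<Longrightarrow> q \<in> R \<Longrightarrow> p - q \<in> R"
    and mult_mem: "\<And>p q. p \<in> R \<Longrightarrow> q \<in> R \<Longrightarrow> p * q \<in> R"
    and gen_mem: "\<And>j. j \<le> N \<Longrightarrow> x j \<in> R"
begin

lemma power_mem: "f \<in> R \<Longrightarrow> f ^ n \<in> R"
  by (induction n) (auto intro: one_mem mult_mem)

lemma prod_gen_mem: "F \<subseteq> {..N} \<Longrightarrow> (\<Prod>j\<in>F. x j) \<in> R"
  by (induction F rule: infinite_finite_induct) (auto intro: one_mem mult_mem gen_mem)

lemma localization_one: "localization R 1 = R"
  unfolding localization_def by simp

lemma zero_mem_localization: "0 \<in> localization R f"
  unfolding localization_def by (simp add: zero_mem)

lemma diff_mem_localization: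
  assumes "f \<in> R" "p \<in> localization R f" "q \<in> localization R f"
  shows "p - q \<in> localization R f"
proof -
  obtain m n where "f ^ m * p \<in> R" "f ^ n * q \<in> R"
    using assms unfolding localization_def by auto
  then have "f ^ n * (f ^ m * p) - f ^ m * (f ^ n * q) \<in> R"
    using assms(1) by (blast intro: diff_mem mult_mem power_mem)
  then have "f ^ (m + n) * (p - q) \<in> R" by (simp add: algebra_simps power_add)
  then show ?thesis unfolding localization_def by blast
qed

lemma add_mem_localization:
  assumes "f \<in> R" "p \<in> localization R f" "q \<in> localization R f"
  shows "p + q \<in> localization R f"
  using diff_mem_localization[OF assms(1,2) diff_mem_localization[OF assms(1)
      zero_mem_localization assms(3)]] by simp

lemma localization_mult_left:
  assumes "f \<in> R" "g \<in> R"
  shows "localization R g \<subseteq> localization R (f * g)"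
proof
  fix q assume "q \<in> localization R g"
  then obtain n where "g ^ n * q \<in> R" unfolding localization_def by blast
  then have "f ^ n * (g ^ n * q) \<in> R" by (blast intro: mult_mem power_mem assms)
  then show "q \<in> localization R (f * g)"
    unfolding localization_def by (auto simp: power_mult_distrib mult.assoc)
qed

text \<open>Since \<open>f\<close> divides a power of \<open>g\<close>, inverting \<open>g\<close>
  already inverts \<open>f\<close>: multiplying by \<open>h ^ n\<close> turns the denominator
  \<open>(f * g) ^ n\<close> into a power of \<open>g\<close>.\<close>

lemma localization_mult_absorb:
  assumes "f \<in> R" "g \<in> R" "h \<in> R" "g ^ M = f * h"
  shows "localization R (f * g) \<subseteq> localization R g"
proof
  fix q assume "q \<in> localization R (f * g)"
  then obtain n where "(f * g) ^ n * q \<in> R" unfolding localization_def by blast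
  then have "h ^ n * ((f * g) ^ n * q) \<in> R" by (blast intro: mult_mem power_mem assms)
  also have "h ^ n * ((f * g) ^ n * q) = ((f * h) * g) ^ n * q"
    by (simp add: power_mult_distrib algebra_simps)
  also have "\<dots> = g ^ (Suc M * n) * q"
    by (simp add: power_mult power_mult_distrib power_add assms(4)[symmetric] mult.commute)
  finally show "q \<in> localization R g" unfolding localization_def by blast
qed

lemma cochain_mem:
  "c \<in> cech_cochains R x N i \<Longrightarrow> F \<subseteq> {..N} \<Longrightarrow> card F = i \<Longrightarrow>
    c F \<in> localization R (\<Prod>j\<in>F. x j)"
  unfolding cech_cochains_def by (auto dest: spec[of _ F])

lemma cochain_eq_0:
  "c \<in> cech_cochains R x N i \<Longrightarrow> \<not> (F \<subseteq> {..N} \<and> card F = i) \<Longrightarrow> c F = 0"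
  unfolding cech_cochains_def by (auto dest: spec[of _ F])

lemma cochains_diff:
  "c \<in> cech_cochains R x N i \<Longrightarrow> c' \<in> cech_cochains R x N i \<Longrightarrow>
    (\<lambda>F. c F - c' F) \<in> cech_cochains R x N i"
  unfolding cech_cochains_def by (auto intro!: diff_mem_localization prod_gen_mem)

lemma zero_cochain: "(\<lambda>F. 0) \<in> cech_cochains R x N i"
  unfolding cech_cochains_def by (simp add: zero_mem_localization)

lemma cech_diff_diff:
  "cech_diff N i (\<lambda>F. c F - c' F) = (\<lambda>F. cech_diff N i c F - cech_diff N i c' F)"
  unfolding cech_diff_def by (auto simp: fun_eq_iff right_diff_distrib sum_subtractf)

lemma cech_diff_0: "cech_diff N i (\<lambda>F. 0) = (\<lambda>F. 0::'a)"
  unfolding cech_diff_def by (auto simp: fun_eq_iff)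

lemma coboundaries_diff:
  assumes "c \<in> cech_coboundaries R x N i" "c' \<in> cech_coboundaries R x N i"
  shows "(\<lambda>F. c F - c' F) \<in> cech_coboundaries R x N i"
proof (cases "i = 0")
  case False
  then obtain b b' where "b \<in> cech_cochains R x N (i - 1)" "b' \<in> cech_cochains R x N (i - 1)"
    "c = cech_diff N (i - 1) b" "c' = cech_diff N (i - 1) b'"
    using assms unfolding cech_coboundaries_def by auto
  with False show ?thesis unfolding cech_coboundaries_def
    by (auto simp: cech_diff_diff[symmetric] intro!: imageI cochains_diff)
qed (use assms in \<open>simp add: cech_coboundaries_def\<close>)

lemma zero_coboundary: "(\<lambda>F. 0) \<in> cech_coboundaries R x N i"
  unfolding cech_coboundaries_def using zero_cochain[of "i - 1"] cech_diff_0[of "i - 1"]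
  by (auto intro!: image_eqI[of _ _ "\<lambda>F. 0"] simp del: One_nat_def)

lemma coboundaries_add:
  assumes "c \<in> cech_coboundaries R x N i" "c' \<in> cech_coboundaries R x N i"
  shows "(\<lambda>F. c F + c' F) \<in> cech_coboundaries R x N i"
  using coboundaries_diff[OF assms(1) coboundaries_diff[OF zero_coboundary assms(2)]] by simp

text \<open>The coset of a coboundary is the group of coboundaries itself. The zero cocycle is
  homogeneous, so the component is nonempty and equals the set containing just this coset.\<close>

lemma local_cohomology_component_trivial:
  assumes "0 \<in> G n"
    and "\<And>c. c \<in> cech_cocycles R x N i \<Longrightarrow> (\<And>F. c F \<in> G n) \<Longrightarrow> c \<in> cech_coboundaries R x N i"
  shows "local_cohomology_component R x N G i n = {cech_coboundaries R x N i}"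
proof -
  let ?Z = "{c \<in> cech_cocycles R x N i. \<forall>F. c F \<in> G n}"
  have "(\<lambda>F. 0) \<in> ?Z"
    using assms(1) by (simp add: cech_cocycles_def zero_cochain cech_diff_0)
  moreover have "{(\<lambda>F. c F + b F) |b. b \<in> cech_coboundaries R x N i} = cech_coboundaries R x N i"
    if "c \<in> ?Z" for c
  proof -
    have c: "c \<in> cech_coboundaries R x N i" using that assms(2) by blast
    have "b \<in> {(\<lambda>F. c F + b F) |b. b \<in> cech_coboundaries R x N i}"
      if "b \<in> cech_coboundaries R x N i" for b
      using coboundaries_diff[OF that c] by (force intro: exI[of _ "\<lambda>F. b F - c F"])
    then show ?thesis using coboundaries_add[OF c] by blast
  qed
  ultimately show ?thesis unfolding local_cohomology_component_def by (auto simp: image_def)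
qed

section \<open>Cocycles of degrees 1 and 2\<close>

lemma cech_diff_pair:
  fixes c :: "nat set \<Rightarrow> 'a"
  assumes "i < j" "j \<le> N"
  shows "cech_diff N 1 c {i, j} = c {j} - c {i}"
proof -
  have "{l. (l = i \<or> l = j) \<and> l < i} = {}" using assms by auto
  then have "(- 1 :: 'a) ^ card {l. (l = i \<or> l = j) \<and> l < i} = 1"
    by (simp only: card.empty power_0)
  moreover have "{l. (l = i \<or> l = j) \<and> l < j} = {i}"
    "{i, j} - {i} = {j}" "{i, j} - {j} = {i}"
    using assms by auto
  ultimately show ?thesis using assms unfolding cech_diff_def
    by (simp add: numeral_2_eq_2)
qed

lemma cech_diff_triple:
  fixes c :: "nat set \<Rightarrow> 'a"
  assumes "h < i" "i < j" "j \<le> N"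
  shows "cech_diff N 2 c {h, i, j} = c {i, j} - c {h, j} + c {h, i}"
proof -
  have "{l. (l = h \<or> l = i \<or> l = j) \<and> l < h} = {}" using assms by auto
  then have "(- 1 :: 'a) ^ card {l. (l = h \<or> l = i \<or> l = j) \<and> l < h} = 1"
    by (simp only: card.empty power_0)
  moreover have
    "{l. (l = h \<or> l = i \<or> l = j) \<and> l < i} = {h}"
    "{l. (l = h \<or> l = i \<or> l = j) \<and> l < j} = {h, i}"
    "{h, i, j} - {h} = {i, j}" "{h, i, j} - {i} = {h, j}" "{h, i, j} - {j} = {h, i}"
    using assms by auto
  ultimately show ?thesis using assms unfolding cech_diff_def
    by (simp add: numeral_2_eq_2)
qed

text \<open>Hence a 1-cocycle amounts to one ring element lying in every
  \<open>localization R (x j)\<close>.\<close>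

lemma one_cocycle_const:
  assumes "c \<in> cech_cocycles R x N 1" "j \<le> N"
  shows "c {j} = c {0}"
proof (cases "j = 0")
  case False
  have "cech_diff N 1 c {0, j} = 0" using assms(1) unfolding cech_cocycles_def by simp
  then show ?thesis using cech_diff_pair[of 0 j c] False assms(2) by simp
qed simp

text \<open>The differential in degree 0 copies the value at the empty set to all singletons, so the
  common value of \<open>c\<close> provides the preimage.\<close>

lemma one_cocycle_coboundary:
  assumes c: "c \<in> cech_cocycles R x N 1" and "c {0} \<in> R"
  shows "c \<in> cech_coboundaries R x N 1"
proof -
  define b where "b F = (if F = {} then c {0} else 0)" for F :: "nat set"
  have "b \<in> cech_cochains R x N 0"
    unfolding cech_cochains_def b_def
    using assms(2) finite_subset[OF _ finite_atMost[of N]] by (auto simp: localization_one)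
  moreover have "cech_diff N 0 b = c"
  proof
    fix F
    show "cech_diff N 0 b F = c F"
    proof (cases "F \<subseteq> {..N} \<and> card F = 1")
      case True
      then obtain j where F: "F = {j}" "j \<le> N" by (auto simp: card_1_singleton_iff)
      have "{l. l = j \<and> l < j} = {}" by auto
      then have "(- 1 :: 'a) ^ card {l. l = j \<and> l < j} = 1"
    by (simp only: card.empty power_0)
      then show ?thesis using one_cocycle_const[OF c F(2)] F
        by (simp add: cech_diff_def b_def)
    next
      case False
      then show ?thesis using c cochain_eq_0[of c 1 F]
        by (auto simp: cech_diff_def cech_cocycles_def)
    qed
  qed
  ultimately show ?thesis unfolding cech_coboundaries_def by auto
qed

text \<open>
  The open sets \<open>x\<^sub>0 \<noteq> 0\<close> and \<open>x\<^sub>N \<noteq> 0\<close> already cover: an intermediate \<open>x\<^sub>j\<close> inverts \<open>x\<^sub>0\<close>, so a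
  splitting of the single component \<open>c {0, N}\<close> propagates to all indices.
\<close>

lemma two_cocycle_coboundary:
  assumes c: "c \<in> cech_cocycles R x N 2" and N: "0 < N"
    and mid: "\<And>j. 0 < j \<Longrightarrow> j < N \<Longrightarrow> \<exists>M. \<exists>h\<in>R. x j ^ M = x 0 * h"
    and p: "p \<in> localization R (x 0)" and p': "p' \<in> localization R (x N)"
    and split: "c {0, N} = p' - p"
  shows "c \<in> cech_coboundaries R x N 2"
proof -
  have cc: "c \<in> cech_cochains R x N 2" using c unfolding cech_cocycles_def by simp
  \<comment> \<open>The potential \<open>e\<close> is normalized by \<open>e 0 = p\<close> and
    forced by \<open>e j - e 0 = c {0, j}\<close>; by the splitting,
    \<open>e N = p'\<close>.\<close>
  define e where "e j = (if j = 0 then p else p + c {0, j})" for j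
  define b where "b F = (if F \<subseteq> {..N} \<and> card F = 1 then e (the_elem F) else 0)" for F
  have e: "e j \<in> localization R (x j)" if j: "j \<le> N" for j
  proof -
    consider "j = 0" | "j = N" "j \<noteq> 0" | "0 < j" "j < N" using j by linarith
    then show ?thesis
    proof cases
      case 3
      have mem: "x 0 \<in> R" "x j \<in> R" using gen_mem j by auto
      obtain M h where h: "h \<in> R" "x j ^ M = x 0 * h" using mid[OF 3] by blast
      have "c {0, j} \<in> localization R (x 0 * x j)"
        using cochain_mem[OF cc, of "{0, j}"] 3 by simp
      moreover have "p \<in> localization R (x 0 * x j)"
        using localization_mult_left[of "x j" "x 0"] mem p by (auto simp: mult.commute)
      ultimately have "p + c {0, j} \<in> localization R (x 0 * x j)"
        using mem by (intro add_mem_localization mult_mem)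
      then show ?thesis using localization_mult_absorb[OF mem h] 3 by (auto simp: e_def)
    qed (use p p' split in \<open>auto simp: e_def\<close>)
  qed
  have ce: "c {i, j} = e j - e i" if "i < j" "j \<le> N" for i j
  proof (cases "i = 0")
    case False
    \<comment> \<open>The cocycle condition on \<open>{0, i, j}\<close> expresses
      \<open>c {i, j}\<close> through the components containing 0.\<close>
    have "cech_diff N 2 c {0, i, j} = 0" using c unfolding cech_cocycles_def by simp
    then show ?thesis using cech_diff_triple[of 0 i j c] that False
      by (simp add: e_def algebra_simps)
  qed (use that in \<open>simp add: e_def\<close>)
  have "b \<in> cech_cochains R x N 1"
    unfolding cech_cochains_def b_def using e by (auto simp: card_1_singleton_iff)
  moreover have "cech_diff N 1 b = c"
  proof
    fix F
    show "cech_diff N 1 b F = c F"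
    proof (cases "F \<subseteq> {..N} \<and> card F = 2")
      case True
      then obtain i j where "F = {i, j}" "i \<noteq> j" by (auto simp: card_2_iff)
      then obtain i j where F: "F = {i, j}" "i < j" "j \<le> N"
        using True by (metis insert_commute insert_subset linorder_neq_iff atMost_iff)
      then show ?thesis using cech_diff_pair[OF F(2,3), of b] ce[OF F(2,3)] by (simp add: b_def)
    next
      case False
      then show ?thesis using cochain_eq_0[OF cc, of F]
        by (auto simp: cech_diff_def numeral_2_eq_2)
    qed
  qed
  ultimately show ?thesis unfolding cech_coboundaries_def by auto
qed

end

section \<open>Vanishing for projective monomial curves\<close>

lemma single_power:
  "Poly_Mapping.single (v :: int \<times> int) (1::'k::field) ^ n =
    Poly_Mapping.single (int n * fst v, int n * snd v) 1"
proof (induction n)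
  case 0
  then show ?case by (simp flip: zero_prod_def)
qed (simp add: mult_single prod_eq_iff algebra_simps plus_prod_def)

text \<open>The support of a product lies in the sum of the supports. Applying this to the monomial
  and to its inverse gives both inclusions.\<close>

lemma keys_single_mult:
  "Poly_Mapping.keys (Poly_Mapping.single (v :: int \<times> int) (1::'k::field) * q) =
    (+) v ` Poly_Mapping.keys q"
proof -
  have sub: "Poly_Mapping.keys (Poly_Mapping.single w (1::'k) * q) \<subseteq> (+) w ` Poly_Mapping.keys q"
    for w :: "int \<times> int" and q
    by (rule order_trans[OF keys_mult]) (simp del: split_paired_Ex, blast)
  have "q = Poly_Mapping.single (- v) 1 * (Poly_Mapping.single v 1 * q)"
    by (simp add: mult.assoc[symmetric] mult_single)
  then have "Poly_Mapping.keys q \<subseteq> (+) (- v) ` Poly_Mapping.keys (Poly_Mapping.single v 1 * q)"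
    using sub by metis
  then have "(+) v ` Poly_Mapping.keys q \<subseteq>
      Poly_Mapping.keys (Poly_Mapping.single v 1 * q)"
    by (force simp: image_iff)
  then show ?thesis using sub by blast
qed

text \<open>The exponents that work for single points of the support combine into one, because the
  support is finite and any larger exponent works too.\<close>

lemma localization_monomial_iff:
  fixes v :: "int \<times> int" and q :: "(int \<times> int) \<Rightarrow>\<^sub>0 'k::field"
  assumes add: "\<And>u w. u \<in> S \<Longrightarrow> w \<in> S \<Longrightarrow> u + w \<in> S" and v: "v \<in> S"
  shows "q \<in> localization (semigroup_ring S) (Poly_Mapping.single v 1) \<longleftrightarrow>
    (\<forall>u \<in> Poly_Mapping.keys q. \<exists>n. (int n * fst v, int n * snd v) + u \<in> S)"
proof -
  have mono: "(int n * fst v, int n * snd v) + u \<in> S"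
    if "m \<le> n" "(int m * fst v, int m * snd v) + u \<in> S" for m n u
    using that
  proof (induction n rule: dec_induct)
    case (step n)
    then have "v + ((int n * fst v, int n * snd v) + u) \<in> S" using add v by blast
    then show ?case by (cases v, cases u) (simp add: algebra_simps)
  qed simp
  have "(\<exists>n. \<forall>u \<in> K. (int n * fst v, int n * snd v) + u \<in> S) \<longleftrightarrow>
    (\<forall>u \<in> K. \<exists>n. (int n * fst v, int n * snd v) + u \<in> S)" if "finite K" for K
    using that
  proof (induction K)
    case (insert w K)
    show ?case
    proof
      assume *: "\<forall>u \<in> insert w K. \<exists>n. (int n * fst v, int n * snd v) + u \<in> S"
      then obtain m n where "\<forall>u \<in> K. (int n * fst v, int n * snd v) + u \<in> S"
        "(int m * fst v, int m * snd v) + w \<in> S"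
        using insert by auto
      then have "\<forall>u \<in> insert w K. (int (max m n) * fst v, int (max m n) * snd v) + u \<in> S"
        using mono max.cobounded1 max.cobounded2 by blast
      then show "\<exists>n. \<forall>u \<in> insert w K. (int n * fst v, int n * snd v) + u \<in> S" by blast
    qed blast
  qed simp
  then show ?thesis
    unfolding localization_def semigroup_ring_def
    by (simp add: single_power keys_single_mult image_subset_iff)
qed

text \<open>Here \<open>p\<close> is minus the part of \<open>q\<close> supported on
  \<open>P\<close>; the sign matches the differential \<open>c {j} - c {i}\<close>.\<close>

lemma keys_split:
  fixes q :: "'b \<Rightarrow>\<^sub>0 'k::ab_group_add"
  shows "\<exists>p p'. q = p' - p \<and> Poly_Mapping.keys p \<subseteq> {u \<in> Poly_Mapping.keys q. P u} \<and>
    Poly_Mapping.keys p' \<subseteq> {u \<in> Poly_Mapping.keys q. \<not> P u}"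
proof (intro exI conjI)
  let ?p = "Poly_Mapping.mapp (\<lambda>u c. if P u then - c else 0) q"
  show "q = (q + ?p) - ?p" by simp
  show "Poly_Mapping.keys ?p \<subseteq> {u \<in> Poly_Mapping.keys q. P u}"
    by (auto simp: in_keys_iff lookup_mapp when_def split: if_splits)
  show "Poly_Mapping.keys (q + ?p) \<subseteq> {u \<in> Poly_Mapping.keys q. \<not> P u}"
    by (auto simp: in_keys_iff lookup_mapp lookup_add when_def split: if_splits)
qed

text \<open>All generators have coordinate sum \<open>a k\<close>, so an element of degree
  \<open>n\<close> is determined by its first coordinate, and membership becomes a question about
  \<open>n\<close>-fold sumsets.\<close>

lemma curve_semigroup_iff:
  "u \<in> curve_semigroup a k \<longleftrightarrow>
    (\<exists>n. fst u \<in> nfold_sumset (a ` {0..k}) n \<and> fst u + snd u = int n * a k)"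
proof
  assume "u \<in> curve_semigroup a k"
  then show "\<exists>n. fst u \<in> nfold_sumset (a ` {0..k}) n \<and> fst u + snd u = int n * a k"
  proof induction
    case zero
    show ?case by (intro exI[of _ 0]) simp
  next
    case (gen i)
    then show ?case by (intro exI[of _ 1]) (auto simp: curve_gen_def)
  next
    case (add u v)
    then obtain m n where "fst u \<in> nfold_sumset (a ` {0..k}) m" "fst u + snd u = int m * a k"
      "fst v \<in> nfold_sumset (a ` {0..k}) n" "fst v + snd v = int n * a k" by blast
    then show ?case
      using nfold_sumset_add[of "fst u" _ m "fst v" n]
      by (intro exI[of _ "m + n"]) (auto simp: algebra_simps)
  qed
next
  assume "\<exists>n. fst u \<in> nfold_sumset (a ` {0..k}) n \<and> fst u + snd u = int n * a k"
  then obtain n where "fst u \<in> nfold_sumset (a ` {0..k}) n" "fst u + snd u = int n * a k"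
    by blast
  then show "u \<in> curve_semigroup a k"
  proof (induction n arbitrary: u)
    case 0
    then have "u = 0" by (simp add: prod_eq_iff)
    then show ?case by (simp add: curve_semigroup.zero)
  next
    case (Suc n)
    then obtain i s where i: "i \<le> k" "fst u = a i + s" "s \<in> nfold_sumset (a ` {0..k}) n" by auto
    then have "(s, int n * a k - s) \<in> curve_semigroup a k" by (intro Suc.IH) auto
    then have "curve_gen a k i + (s, int n * a k - s) \<in> curve_semigroup a k"
      using i by (intro curve_semigroup.add curve_semigroup.gen)
    moreover have "curve_gen a k i + (s, int n * a k - s) = u"
      using Suc.prems i by (simp add: curve_gen_def prod_eq_iff algebra_simps)
    ultimately show ?case by simp
  qed
qed

lemma cech_semigroup_ring:
  "cech (semigroup_ring (curve_semigroup a k) :: ((int \<times> int) \<Rightarrow>\<^sub>0 'k::field) set)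
    (curve_monomial a k) k"
proof
  fix p q :: "(int \<times> int) \<Rightarrow>\<^sub>0 'k"
  assume "p \<in> semigroup_ring (curve_semigroup a k)" "q \<in> semigroup_ring (curve_semigroup a k)"
  then have "Poly_Mapping.keys p \<subseteq> curve_semigroup a k" "Poly_Mapping.keys q \<subseteq> curve_semigroup a k"
    unfolding semigroup_ring_def by auto
  then show "p - q \<in> semigroup_ring (curve_semigroup a k)"
    "p * q \<in> semigroup_ring (curve_semigroup a k)"
    unfolding semigroup_ring_def using keys_diff[of p q] keys_mult[of p q]
    by (blast intro: curve_semigroup.add)+
qed (auto simp: semigroup_ring_def curve_monomial_def curve_semigroup.intros)

section \<open>Vanishing criteria for graded components\<close>

text \<open>The common value of a 1-cocycle lies in the localizations at the two extremal monomials;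
  \<open>sat\<close> brings each exponent of its support back into the semigroup.\<close>

lemma component_one_trivial:
  assumes sat: "\<And>u m m'. fst u + snd u = n * a k \<Longrightarrow>
      (int m * a 0, int m * (a k - a 0)) + u \<in> curve_semigroup a k \<Longrightarrow>
      (int m' * a k, 0) + u \<in> curve_semigroup a k \<Longrightarrow> u \<in> curve_semigroup a k"
  defines "R \<equiv> semigroup_ring (curve_semigroup a k) :: ((int \<times> int) \<Rightarrow>\<^sub>0 'k::field) set"
  shows "local_cohomology_component R (curve_monomial a k) k (homogeneous_part (a k)) 1 n =
    {cech_coboundaries R (curve_monomial a k) k 1}"
proof -
  interpret cech R "curve_monomial a k" k unfolding R_def by (rule cech_semigroup_ring)
  show ?thesis
  proof (rule local_cohomology_component_trivial)
    fix c assume c: "c \<in> cech_cocycles R (curve_monomial a k) k 1"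
      and hom: "\<And>F. c F \<in> homogeneous_part (a k) n"
    have cc: "c \<in> cech_cochains R (curve_monomial a k) k 1"
      using c unfolding cech_cocycles_def by simp
    have loc: "c {0} \<in> localization R (curve_monomial a k j)" if "j \<le> k" for j
      using cochain_mem[OF cc, of "{j}"] one_cocycle_const[OF c that] that by simp
    have "c {0} \<in> R"
      unfolding R_def semigroup_ring_def
    proof (intro CollectI subsetI)
      fix u assume u: "u \<in> Poly_Mapping.keys (c {0})"
      have "\<exists>m. (int m * fst (curve_gen a k j), int m * snd (curve_gen a k j)) + u
          \<in> curve_semigroup a k" if "j \<le> k" for j
        using loc[OF that] u that unfolding R_def curve_monomial_def
        by (subst (asm) localization_monomial_iff)
           (auto intro: curve_semigroup.intros)
      from this[of 0] this[of k] show "u \<in> curve_semigroup a k"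
        using sat[of u] hom[of "{0}"] u by (auto simp: homogeneous_part_def curve_gen_def)
    qed
    then show "c \<in> cech_coboundaries R (curve_monomial a k) k 1"
      by (rule one_cocycle_coboundary[OF c])
  qed (simp add: homogeneous_part_def)
qed

text \<open>By \<open>cover\<close>, each exponent of \<open>c {0, k}\<close> belongs to one of the
  two extremal localizations, so the polynomial splits by support. By \<open>mid\<close>, the first
  monomial divides a power of every intermediate one.\<close>

lemma component_two_trivial:
  assumes k: "0 < k"
    and cover: "\<And>u. fst u + snd u = n * a k \<Longrightarrow>
      (\<exists>m. (int m * a 0, int m * (a k - a 0)) + u \<in> curve_semigroup a k) \<or>
      (\<exists>m. (int m * a k, 0) + u \<in> curve_semigroup a k)"
    and mid: "\<And>j. 0 < j \<Longrightarrow> j < k \<Longrightarrow> \<exists>M. \<exists>w \<in> curve_semigroup a k.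
      (int M * a j, int M * (a k - a j)) = curve_gen a k 0 + w"
  defines "R \<equiv> semigroup_ring (curve_semigroup a k) :: ((int \<times> int) \<Rightarrow>\<^sub>0 'k::field) set"
  shows "local_cohomology_component R (curve_monomial a k) k (homogeneous_part (a k)) 2 n =
    {cech_coboundaries R (curve_monomial a k) k 2}"
proof -
  interpret cech R "curve_monomial a k" k unfolding R_def by (rule cech_semigroup_ring)
  show ?thesis
  proof (rule local_cohomology_component_trivial)
    fix c assume c: "c \<in> cech_cocycles R (curve_monomial a k) k 2"
      and hom: "\<And>F. c F \<in> homogeneous_part (a k) n"
    let ?P = "\<lambda>j u. \<exists>m. (int m * fst (curve_gen a k j), int m * snd (curve_gen a k j)) + u
      \<in> curve_semigroup a k"
    have P: "?P 0 u \<or> ?P k u" if "u \<in> Poly_Mapping.keys (c {0, k})" for u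
      using cover[of u] that hom[of "{0, k}"] by (auto simp: homogeneous_part_def curve_gen_def)
    obtain p p' where split: "c {0, k} = p' - p"
      and keys: "Poly_Mapping.keys p \<subseteq> {u \<in> Poly_Mapping.keys (c {0, k}). ?P 0 u}"
      "Poly_Mapping.keys p' \<subseteq> {u \<in> Poly_Mapping.keys (c {0, k}). \<not> ?P 0 u}"
      using keys_split[of "c {0, k}" "?P 0"] by blast
    have loc: "q \<in> localization R (curve_monomial a k j)"
      if "\<And>u. u \<in> Poly_Mapping.keys q \<Longrightarrow> ?P j u" "j \<le> k" for q j
      using that unfolding R_def curve_monomial_def
      by (subst localization_monomial_iff) (auto intro: curve_semigroup.intros)
    show "c \<in> cech_coboundaries R (curve_monomial a k) k 2"
    proof (rule two_cocycle_coboundary[OF c k _ _ _ split])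
      show "p \<in> localization R (curve_monomial a k 0)" using keys by (intro loc) auto
      show "p' \<in> localization R (curve_monomial a k k)" using keys P by (intro loc) blast+
      fix j assume "0 < j" "j < k"
      then obtain M w where "w \<in> curve_semigroup a k"
        "(int M * a j, int M * (a k - a j)) = curve_gen a k 0 + w" using mid by blast
      then show "\<exists>M. \<exists>h\<in>R. curve_monomial a k j ^ M = curve_monomial a k 0 * h"
        unfolding R_def semigroup_ring_def curve_monomial_def
        by (intro exI[of _ M] bexI[of _ "Poly_Mapping.single w 1"])
           (auto simp: single_power mult_single curve_gen_def)
    qed
  qed (simp add: homogeneous_part_def)
qed

section \<open>From vanishing to a bound on the regularity\<close>

lemma curve_a_invariant_le:
  assumes "\<And>n. B < n \<Longrightarrow>
    local_cohomology_component (semigroup_ring (curve_semigroup a k) :: ((int \<times> int) \<Rightarrow>\<^sub>0 'k) set)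
      (curve_monomial a k) k (homogeneous_part (a k)) i n =
    {cech_coboundaries (semigroup_ring (curve_semigroup a k)) (curve_monomial a k) k i}"
  shows "curve_a_invariant TYPE('k::field) a k i \<le> ereal (of_int B)"
  unfolding curve_a_invariant_def a_invariant_def
proof (rule Sup_least, clarify)
  fix n assume "local_cohomology_component
      (semigroup_ring (curve_semigroup a k) :: ((int \<times> int) \<Rightarrow>\<^sub>0 'k) set)
      (curve_monomial a k) k (homogeneous_part (a k)) i n \<noteq>
    {cech_coboundaries (semigroup_ring (curve_semigroup a k)) (curve_monomial a k) k i}"
  then have "n \<le> B" using assms[of n] by force
  then show "ereal (of_int n) \<le> ereal (of_int B)" by simp
qed

text \<open>With \<open>B\<close> the claimed bound, it suffices that H^1 vanishes in degrees at
  least \<open>B\<close> and H^2 in degrees at least \<open>B - 1\<close>; the argument for H^2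
  works from degree 1 on.\<close>

lemma curve_reg_le:
  fixes a :: "nat \<Rightarrow> int" and k :: nat and p e \<epsilon> \<delta> \<mu> :: int
  defines "A \<equiv> a ` {0..k}"
  assumes a0: "a 0 = 0" and k: "0 < k" and range: "\<And>j. 0 < j \<Longrightarrow> j < k \<Longrightarrow> 0 < a j \<and> a j < a k"
    and gap_set: "gap_set A (a k) \<delta> \<mu>"
    and \<epsilon>: "0 < \<epsilon>" "\<And>x. x \<in> A \<Longrightarrow> x \<noteq> 0 \<Longrightarrow> \<epsilon> \<le> x"
    and low: "{\<epsilon>..e} \<subseteq> A" "\<epsilon> \<le> e" "p - e - 1 \<le> \<mu>"
    and block: "{p..p + \<epsilon> - 1} \<subseteq> A" "0 < p"
  shows "curve_reg TYPE('k::field) a k \<le> ereal (of_int (2 + max (\<mu> div \<delta>) (\<mu> div \<epsilon>)))"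
proof -
  interpret gap_set A "a k" \<delta> \<mu> by (rule gap_set)
  define B where "B = 2 + max (\<mu> div \<delta>) (\<mu> div \<epsilon>)"
  have \<epsilon>A: "\<epsilon> \<in> A" and pA: "p \<in> A" using low block \<epsilon> by auto
  have A_le: "x \<le> a k" if x: "x \<in> A" for x
  proof -
    obtain j where j: "x = a j" "j \<le> k" using x unfolding A_def by auto
    then consider "j = 0" | "j = k" | "0 < j" "j < k" by linarith
    then show ?thesis using j range[of j] a0 d_pos by cases auto
  qed
  have p_le: "p \<le> a k" using A_le pA by blast
  have B2: "2 \<le> B" "2 + \<mu> div \<epsilon> \<le> B"
    using \<mu>_nonneg \<delta>_pos unfolding B_def by (auto simp: pos_imp_zdiv_nonneg_iff le_max_iff_disj)
  have S: "u \<in> curve_semigroup a k \<longleftrightarrow>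
      (\<exists>n. fst u \<in> nfold_sumset A n \<and> fst u + snd u = int n * a k)" for u
    unfolding A_def by (rule curve_semigroup_iff)
  have le: "x \<le> int n * a k" if "x \<in> nfold_sumset A n" for x n
    using that by (induction n arbitrary: x) (auto simp: algebra_simps intro!: add_mono A_le)
  have sat: "u \<in> curve_semigroup a k"
    if n: "B \<le> n" and u: "fst u + snd u = n * a k"
      and m: "(int m * a 0, int m * (a k - a 0)) + u \<in> curve_semigroup a k"
      and m': "(int m' * a k, 0) + u \<in> curve_semigroup a k" for n u m m'
  proof -
    \<comment> \<open>Since \<open>a 0 = 0\<close>, adding copies of the generator at 0 changes only
      the second coordinate.\<close>
    obtain l where l: "fst u \<in> nfold_sumset A l" using m unfolding S by (auto simp: a0)
    obtain l' where l': "int m' * a k + fst u \<in> nfold_sumset A l'"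
      "int m' * a k + fst u + snd u = int l' * a k"
      using m' unfolding S by (auto simp: algebra_simps)
    \<comment> \<open>Adding copies of the generator at \<open>k\<close> leaves \<open>snd u\<close>
      unchanged, and semigroup elements have nonnegative second coordinate.\<close>
    have "0 \<le> snd u" using le[OF l'(1)] l'(2) by linarith
    then have u1: "fst u \<le> int (nat n) * a k" using u n B2 by simp
    have nB: "B \<le> int (nat n)" using n by simp
    have "fst u \<in> nfold_sumset A (nat n)"
    proof (cases "p \<le> fst u")
      case True
      then show ?thesis
        using mem_of_long_block[OF block(1) \<epsilon>A \<epsilon>(1) block(2) _ u1] nB unfolding B_def by blast
    next
      case False
      then show ?thesis
        using mem_of_small[OF zero_mem \<epsilon> low \<mu>_nonneg l] nB B2 by simp
    qed
    then show ?thesis unfolding S using u n B2 by (intro exI[of _ "nat n"]) simp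
  qed
  have cover: "(\<exists>m. (int m * a 0, int m * (a k - a 0)) + u \<in> curve_semigroup a k) \<or>
      (\<exists>m. (int m * a k, 0) + u \<in> curve_semigroup a k)"
    if n: "1 \<le> n" and u: "fst u + snd u = n * a k" for n u
  proof (cases "0 \<le> snd u")
    case True
    \<comment> \<open>After adding \<open>snd u\<close> copies of the generator at \<open>k\<close>,
      the degree is \<open>M\<close> and the first coordinate falls short of \<open>M * a k\<close>
      by \<open>snd u \<le> M * \<delta>\<close>, which the top interval can absorb.\<close>
    define M where "M = nat (n + snd u)"
    have M: "int M = n + snd u" unfolding M_def using n True by simp
    have "snd u * 1 \<le> int M * \<delta>" using M n \<delta>_pos True by (intro mult_mono) auto
    then have "int M * a k - snd u \<in> nfold_sumset A M"
      using nfold_sumset_top[OF top, of "snd u" M] \<delta>_pos True by simp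
    moreover have "int M * a k - snd u = fst ((int (nat (snd u)) * a k, 0) + u)"
      using M True u by (simp add: algebra_simps)
    ultimately have "fst ((int (nat (snd u)) * a k, 0) + u) \<in> nfold_sumset A M" by simp
    moreover have "fst ((int (nat (snd u)) * a k, 0) + u) + snd ((int (nat (snd u)) * a k, 0) + u)
        = int M * a k"
      using M True u by (simp add: algebra_simps)
    ultimately have "(int (nat (snd u)) * a k, 0) + u \<in> curve_semigroup a k"
      unfolding S by blast
    then show ?thesis by blast
  next
    case False
    \<comment> \<open>Now \<open>fst u\<close> exceeds \<open>n * a k\<close>. Adding
      \<open>m\<close> copies of the generator at 0 raises the degree to \<open>M\<close>; this
      \<open>m\<close> ensures both \<open>fst u \<le> M * a k\<close> and
      \<open>B \<le> M\<close>.\<close>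
    define m where "m = nat (B - snd u)"
    define M where "M = nat n + m"
    have m: "int m = B - snd u" unfolding m_def using B2 False by simp
    have M: "int M = n + int m" unfolding M_def using n by simp
    have "1 * a k \<le> n * a k" using n d_pos by (intro mult_right_mono) auto
    then have p: "p \<le> fst u" using p_le u False by linarith
    have "int m * 1 \<le> int m * a k" using d_pos by (intro mult_left_mono) auto
    moreover have "int M * a k = n * a k + int m * a k" by (simp add: M algebra_simps)
    ultimately have "fst u \<le> int M * a k" using u m B2 by linarith
    moreover have "B \<le> int M" using M m n False by linarith
    ultimately have "fst u \<in> nfold_sumset A M"
      using mem_of_long_block[OF block(1) \<epsilon>A \<epsilon>(1) block(2) p] unfolding B_def by blast
    then have "(int m * a 0, int m * (a k - a 0)) + u \<in> curve_semigroup a k"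
      unfolding S using M u by (intro exI[of _ M]) (auto simp: algebra_simps a0)
    then show ?thesis by blast
  qed
  have mid: "\<exists>M. \<exists>w \<in> curve_semigroup a k.
      (int M * a j, int M * (a k - a j)) = curve_gen a k 0 + w" if j: "0 < j" "j < k" for j
  proof (intro exI bexI)
    \<comment> \<open>This is \<open>a j\<close> copies of the generator at \<open>k\<close> plus
      \<open>a k - a j - 1\<close> copies of the generator at 0.\<close>
    let ?w = "(a k * a j, a k * (a k - a j) - a k)"
    show "(int (nat (a k)) * a j, int (nat (a k)) * (a k - a j)) = curve_gen a k 0 + ?w"
      using d_pos a0 by (simp add: curve_gen_def)
    have "int (nat (a j)) * a k \<in> nfold_sumset A (nat (a j))"
      by (rule nfold_sumset_scale[OF d_mem])
    moreover have "nat (a j) \<le> nat (a k - 1)" using range[OF j] by (intro nat_mono) linarith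
    ultimately have "a k * a j \<in> nfold_sumset A (nat (a k - 1))"
      using nfold_sumset_mono[OF zero_mem] range[OF j] by (simp add: mult.commute)
    then show "?w \<in> curve_semigroup a k"
      unfolding S using d_pos by (intro exI[of _ "nat (a k - 1)"]) (auto simp: algebra_simps)
  qed
  have "curve_a_invariant TYPE('k) a k 1 \<le> ereal (of_int (B - 1))"
    by (intro curve_a_invariant_le component_one_trivial; rule sat; (assumption | linarith))
  then have 1: "curve_a_invariant TYPE('k) a k 1 + 1 \<le> ereal (of_int B)"
    using add_right_mono[of _ "ereal (of_int (B - 1))" 1] by (simp add: one_ereal_def)
  have "curve_a_invariant TYPE('k) a k 2 \<le> ereal (of_int (B - 2))"
  proof (intro curve_a_invariant_le component_two_trivial k)
    fix n u assume "B - 2 < n" "fst u + snd u = n * a k"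
    then show "(\<exists>m. (int m * a 0, int m * (a k - a 0)) + u \<in> curve_semigroup a k) \<or>
        (\<exists>m. (int m * a k, 0) + u \<in> curve_semigroup a k)"
      using B2 by (intro cover[of n]) linarith+
  qed (rule mid)
  then have 2: "curve_a_invariant TYPE('k) a k 2 + 2 \<le> ereal (of_int B)"
    using add_right_mono[of _ "ereal (of_int (B - 2))" 2] by (simp add: numeral_eq_ereal)
  from 1 2 show ?thesis unfolding curve_reg_def B_def[symmetric] by simp
qed

section \<open>Gaps of an increasing sequence\<close>

context
  fixes a :: "nat \<Rightarrow> int" and k :: nat
  assumes step: "\<And>i. i < k \<Longrightarrow> a i < a (Suc i)"
begin

lemma strict_increasing: "i < j \<Longrightarrow> j \<le> k \<Longrightarrow> a i < a j"
proof (induction j)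
  case (Suc j)
  then have "a j < a (Suc j)" by (intro step) simp
  with Suc show ?case by (cases "i = j") auto
qed simp

lemma gap_nonneg: "i \<in> {1..k} \<Longrightarrow> 0 \<le> gap a i"
  using step[of "i - 1"] by (cases i) (auto simp: gap_def)

lemma gap_le_max: "i \<in> {1..k} \<Longrightarrow> gap a i \<le> gap_max a k"
  unfolding gap_max_def by (intro Max_ge) auto

lemma gap_second_nonneg:
  assumes "2 \<le> k"
  shows "0 \<le> gap_second a k"
proof -
  define i where "i = (SOME i. i \<in> {1..k} \<and> gap a i = gap_max a k)"
  obtain j where j: "j \<in> {1..k} - {i}"
    using assms by (cases "i = 1") (auto intro: that[of 1] that[of 2])
  have "0 \<le> gap a j" using j by (intro gap_nonneg) auto
  also have "\<dots> \<le> Max (gap a ` ({1..k} - {i}))" using j by (intro Max_ge) auto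
  finally show ?thesis unfolding gap_second_def Let_def i_def .
qed

text \<open>With \<open>i\<close> the least index such that \<open>y \<le> a i\<close>, the
  neighbours are \<open>a (i - 1)\<close> and \<open>a i\<close>.\<close>

lemma exists_surrounding_gap:
  assumes "a 0 \<le> y" "y \<le> a k" "y \<notin> a ` {0..k}"
  shows "\<exists>l h. l \<in> a ` {0..k} \<and> h \<in> a ` {0..k} \<and> l < y \<and> y < h \<and> h - l - 1 \<le> gap_max a k"
proof -
  define i where "i = (LEAST i. y \<le> a i)"
  have i: "y \<le> a i" unfolding i_def by (rule LeastI) fact
  have ik: "i \<le> k" unfolding i_def by (rule Least_le) fact
  have "i \<noteq> 0" using i assms ik by (metis atLeastAtMost_iff image_eqI le0 order_antisym)
  then have "a (i - 1) < y" using not_less_Least[of "i - 1" "\<lambda>i. y \<le> a i"] unfolding i_def by simp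
  moreover have "y < a i" using i ik assms(3) by (cases "y = a i") auto
  moreover have "a i - a (i - 1) - 1 \<le> gap_max a k"
    using gap_le_max[of i] ik \<open>i \<noteq> 0\<close> by (simp add: gap_def)
  ultimately show ?thesis using ik by (intro exI[of _ "a (i - 1)"] exI[of _ "a i"]) auto
qed

end

theorem proposition4p11:
  fixes a b :: "nat \<Rightarrow> int" and k r :: nat and d :: int
  assumes "k \<ge> 3"
    and "a 0 = 0" and "\<And>i. i < k \<Longrightarrow> a i < a (Suc i)" and "a k = d"
    and "Gcd (a ` {1..k}) = 1"
    and "r \<ge> 2"
    and "b 0 = 0" and "b (2 * r + 1) = d"
    and "\<And>j. j \<le> r \<Longrightarrow> b (2 * j) \<le> b (2 * j + 1)"
    and "\<And>j. 1 \<le> j \<Longrightarrow> j \<le> r \<Longrightarrow> b (2 * j - 1) + 2 \<le> b (2 * j)"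
    and "disjoint_family_on (\<lambda>j. {b (2 * j)..b (2 * j + 1)}) {0..r}"
    and "a ` {0..k} = (\<Union>j\<in>{0..r}. {b (2 * j)..b (2 * j + 1)})"
    and "b 1 = 0" and "b (2 * r) < d" and "b 5 - b 4 + 1 \<ge> b 2"
  shows "curve_reg TYPE('k::field) a k \<le>
    ereal (of_int (2 + max
      (\<lfloor>real_of_int (gap_second a k) / real_of_int (d - b (2 * r))\<rfloor>
         + \<lfloor>real_of_int (gap_max a k) / real_of_int (b 2)\<rfloor>)
      (\<lfloor>real_of_int (gap_max a k) / real_of_int (d - b (2 * r))\<rfloor>
         + \<lfloor>real_of_int (gap_second a k) / real_of_int (b 2)\<rfloor>)))"
proof -
  note k = \<open>k \<ge> 3\<close> and a0 = \<open>a 0 = 0\<close> and step = \<open>\<And>i. i < k \<Longrightarrow> a i < a (Suc i)\<close>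
    and ak = \<open>a k = d\<close> and r = \<open>r \<ge> 2\<close> and b_last = \<open>b (2 * r + 1) = d\<close>
    and b_le = \<open>\<And>j. j \<le> r \<Longrightarrow> b (2 * j) \<le> b (2 * j + 1)\<close>
    and b_gap = \<open>\<And>j. 1 \<le> j \<Longrightarrow> j \<le> r \<Longrightarrow> b (2 * j - 1) + 2 \<le> b (2 * j)\<close>
    and A = \<open>a ` {0..k} = (\<Union>j\<in>{0..r}. {b (2 * j)..b (2 * j + 1)})\<close>
  let ?A = "a ` {0..k}" and ?\<delta> = "d - b (2 * r)"
  have interval: "{b (2 * j)..b (2 * j + 1)} \<subseteq> ?A" if "j \<le> r" for j
    using that unfolding A by force
  have b2: "2 \<le> b 2" using b_gap[of 1] r \<open>b 1 = 0\<close> by simp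
  have b23: "b 2 \<le> b 3" using b_le[of 1] r by (simp add: eval_nat_numeral)
  have b34: "b 3 + 2 \<le> b 4" using b_gap[of 2] r by simp
  have b4: "b 4 \<le> b (2 * j)" if "2 \<le> j" "j \<le> r" for j
    using that
  proof (induction j rule: dec_induct)
    case (step j)
    then show ?case using b_le[of j] b_gap[of "Suc j"] by simp
  qed simp
  \<comment> \<open>Below \<open>b 4\<close> the set consists of 0 and \<open>[b 2, b 3]\<close>
    only, because \<open>b 1 = 0\<close>.\<close>
  have A_cases: "y = 0 \<or> b 2 \<le> y \<and> y \<le> b 3 \<or> b 4 \<le> y" if y: "y \<in> ?A" for y
  proof -
    obtain j where j: "j \<le> r" "b (2 * j) \<le> y" "y \<le> b (2 * j + 1)" using y unfolding A by auto
    consider "j = 0" | "j = 1" | "2 \<le> j" by linarith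
    then show ?thesis
    proof cases
      case 1
      then show ?thesis using j \<open>b 0 = 0\<close> \<open>b 1 = 0\<close> by simp
    next
      case 2
      then show ?thesis using j by (simp add: eval_nat_numeral)
    next
      case 3
      then show ?thesis using b4[OF 3] j by linarith
    qed
  qed
  have gap_max: "0 \<le> gap_max a k"
    using gap_nonneg[of k a 1] gap_le_max[of k a 1] step k by force
  have gap_second: "0 \<le> gap_second a k" using gap_second_nonneg[of k a] step k by simp
  have surround: "\<exists>l h. l \<in> ?A \<and> h \<in> ?A \<and> l < y \<and> y < h \<and> h - l - 1 \<le> gap_max a k"
    if "0 \<le> y" "y \<le> d" "y \<notin> ?A" for y
    using exists_surrounding_gap[of k a y] step that a0 ak by simp
  have "0 < a k" using strict_increasing[of k a 0 k] step a0 k by simp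
  then have "gap_set ?A d ?\<delta> (gap_max a k)"
    using surround gap_max \<open>b (2 * r) < d\<close> interval[of r] b_last a0 ak
    by unfold_locales (auto simp: image_iff intro: bexI[of _ 0] bexI[of _ k])
  moreover have "b 4 - b 3 - 1 \<le> gap_max a k"
  proof -
    \<comment> \<open>Any elements of the set on either side of \<open>b 3 + 1\<close> enclose the
      entire hole between \<open>b 3\<close> and \<open>b 4\<close>.\<close>
    have "b 3 + 1 \<notin> ?A" using A_cases[of "b 3 + 1"] b2 b23 b34 by linarith
    moreover have "b 3 + 1 \<le> d" using b4[of r] r \<open>b (2 * r) < d\<close> b34 by simp
    ultimately obtain l h where "h \<in> ?A" "l < b 3 + 1" "b 3 + 1 < h" "h - l - 1 \<le> gap_max a k"
      using surround[of "b 3 + 1"] b2 b23 by auto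
    then show ?thesis using A_cases[of h] b2 b23 by linarith
  qed
  moreover have "{b 2..b 3} \<subseteq> ?A" "{b 4..b 4 + b 2 - 1} \<subseteq> ?A"
    using interval[of 1] interval[of 2] r \<open>b 5 - b 4 + 1 \<ge> b 2\<close> by (auto simp: eval_nat_numeral)
  moreover have "b 2 \<le> y" if "y \<in> ?A" "y \<noteq> 0" for y
    using A_cases[OF that(1)] that(2) b23 b34 by linarith
  moreover have "0 < a j \<and> a j < a k" if "0 < j" "j < k" for j
    using strict_increasing[of k a 0 j] strict_increasing[of k a j k] step that a0 by simp
  ultimately have "curve_reg TYPE('k) a k \<le>
      ereal (of_int (2 + max (gap_max a k div ?\<delta>) (gap_max a k div b 2)))"
    using a0 k ak b2 b23 b34 by (intro curve_reg_le[where e = "b 3" and p = "b 4"]) auto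
  \<comment> \<open>Each quotient of the largest gap occurs in one of the two sums of the claim,
    next to a nonnegative quotient of the second largest gap.\<close>
  also have "0 \<le> gap_second a k div ?\<delta>" "0 \<le> gap_second a k div b 2"
    using gap_second \<open>b (2 * r) < d\<close> b2 by (auto simp: pos_imp_zdiv_nonneg_iff)
  then have "ereal (of_int (2 + max (gap_max a k div ?\<delta>) (gap_max a k div b 2))) \<le>
      ereal (of_int (2 + max (gap_second a k div ?\<delta> + gap_max a k div b 2)
        (gap_max a k div ?\<delta> + gap_second a k div b 2)))"
    unfolding ereal_less_eq of_int_le_iff by linarith
  finally show ?thesis by (simp only: floor_divide_of_int_eq)
qed

end
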